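(* Every lattice $2$-zonotope $Z$ of lattice-width at least three has $\mu(Z)\le\frac12$, except if $Z$ is unimodularly equivalent to the parallelogram $P_{2,5}=[\mathbf 0,(1,0)]+[\mathbf 0,(2,5)]$, which has area $5$ and $\mu(P_{2,5})=\frac35$.
   Context: A lattice $2$-zonotope is a two-dimensional zonotope in $\mathbb{R}^2$ that is a lattice translate of $\sum_{i}[\mathbf 0,\mathbf u_i]$ with finitely many generators $\mathbf u_i\in\mathbb{Z}^2$. The covering radius of a convex body $C\subseteq\mathbb{R}^d$ is $\mu(C)=\min\{\rho>0:\rho C+\mathbb{Z}^d=\mathbb{R}^d\}$. The lattice-width of $C$ is the minimum, over $\mathbf z\in\mathbb{Z}^d\setminus\{\mathbf 0\}$, of $\max_{\mathbf x\in C}\mathbf z^\intercal\mathbf x-\min_{\mathbf x\in C}\mathbf z^\intercal\mathbf x$. Two lattice polytopes $P,Q\subseteq\mathbb{R}^d$ are unimodularly equivalent if $P=UQ+\mathbf t$ for some $U\in\mathbb{Z}^{d\times d}$ with $|\det U|=1$ and $\mathbf t\in\mathbb{Z}^d$. *)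

theory Defs
  imports "HOL-Analysis.Analysis"
begin

definition int_lattice :: "(real ^ 'n) set" where
  "int_lattice = {x. \<forall>i. x $ i \<in> \<int>}"

(* The sum of sets is the Minkowski sum of HOL-Library.Set_Algebras.  The generators form a
   list because repetitions matter; aff_dim Z = 2 excludes points and segments. *)
definition lattice_2_zonotope :: "(real ^ 2) set \<Rightarrow> bool" where
  "lattice_2_zonotope Z \<longleftrightarrow>
     (\<exists>us t. set us \<subseteq> int_lattice \<and> t \<in> int_lattice \<and>
        Z = (+) t ` (\<Sum>u\<leftarrow>us. closed_segment 0 u)) \<and>
     aff_dim Z = 2"

(* For a convex body (compact, convex, nonempty interior) the set of admissible dilation
   factors is nonempty and has a minimum, so Inf is that minimum. *)
definition covering_radius :: "(real ^ 'n) set \<Rightarrow> real" where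
  "covering_radius C = Inf {\<rho>. \<rho> > 0 \<and> (\<lambda>x. \<rho> *\<^sub>R x) ` C + int_lattice = UNIV}"

(* For a convex body all three extrema are attained. *)
definition lattice_width :: "(real ^ 'n) set \<Rightarrow> real" where
  "lattice_width C =
     (INF z\<in>int_lattice - {0}. (SUP x\<in>C. z \<bullet> x) - (INF x\<in>C. z \<bullet> x))"

definition unimodularly_equivalent :: "(real ^ 'n) set \<Rightarrow> (real ^ 'n) set \<Rightarrow> bool" where
  "unimodularly_equivalent P Q \<longleftrightarrow>
     (\<exists>(U :: real ^ 'n ^ 'n) t. (\<forall>i j. U $ i $ j \<in> \<int>) \<and> \<bar>det U\<bar> = 1 \<and> t \<in> int_lattice \<and>
        P = (\<lambda>x. U *v x + t) ` Q)"

definition P25 :: "(real ^ 2) set" where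
  "P25 = closed_segment 0 (vector [1, 0]) + closed_segment 0 (vector [2, 5])"

end

theory Submission
  imports Defs
begin

text \<open>
  The width function \<open>w(z) = \<Sum> \<bar>z \<bullet> u\<^sub>i\<bar>\<close> is a norm that is integral on lattice vectors and determines
  the zonotope \<open>Z\<close> up to translation.  Let \<open>e, f\<close> be a lattice basis (of the dual lattice) and put
  \<open>G(s) = w(f + s e)\<close>.  By duality, the two chords of the centred body \<open>Z/2\<close> on the lines
  \<open>e \<bullet> x = \<plusminus>1/2\<close> have length at least 1, measured by \<open>f\<close>, as soon as
  \<open>G(s) + G(s') \<ge> 4 + 2 (s - s')\<close> for all real \<open>s, s'\<close>; their convex hull then contains a
  parallelogram that tiles the plane by lattice translations, so \<open>Z/2\<close> covers.

  Choose \<open>e\<close> with \<open>a = w(e)\<close> minimal.  Then \<open>G\<close> is convex and \<open>a\<close>-Lipschitz, is at least \<open>a\<close> at the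
  integers and satisfies \<open>G(s) + G(s') \<ge> a \<bar>s - s'\<bar>\<close>; for \<open>a \<ge> 4\<close> these properties imply the chord
  inequality.  For \<open>a = 3\<close> the generators have \<open>e\<close>-coordinates \<open>1, 1, 1\<close> or \<open>2, 1\<close> or \<open>3\<close>, up to sign and
  up to generators with \<open>e\<close>-coordinate 0.  Up to shears and reflections, only five such zonotopes violate the chord
  inequality for \<open>e, f\<close>.  Four of them satisfy it for another basis, and the fifth is \<open>P\<^sub>2\<^sub>,\<^sub>5\<close>.
\<close>

section \<open>Zonotopes and their width functions\<close>

definition wid :: "(real ^ 2) list \<Rightarrow> real ^ 2 \<Rightarrow> real" where
  "wid us z = (\<Sum>u\<leftarrow>us. \<bar>z \<bullet> u\<bar>)"

abbreviation zono :: "(real ^ 2) list \<Rightarrow> (real ^ 2) set" where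
  "zono us \<equiv> (\<Sum>u\<leftarrow>us. closed_segment 0 u)"

lemma wid_simps [simp]: "wid [] z = 0" "wid (u # us) z = \<bar>z \<bullet> u\<bar> + wid us z"
  by (auto simp: wid_def)

lemma wid_nonneg [simp]: "0 \<le> wid us z"
  by (induction us) auto

lemma wid_triangle: "wid us (x + y) \<le> wid us x + wid us y"
proof (induction us)
  case (Cons u us)
  have "\<bar>(x + y) \<bullet> u\<bar> \<le> \<bar>x \<bullet> u\<bar> + \<bar>y \<bullet> u\<bar>"
    by (simp add: inner_add_left)
  with Cons show ?case by simp
qed simp

lemma wid_scaleR [simp]: "wid us (r *\<^sub>R z) = \<bar>r\<bar> * wid us z"
  by (induction us) (auto simp: algebra_simps abs_mult)

lemma wid_minus [simp]: "wid us (- z) = wid us z"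
  using wid_scaleR[of us "-1" z] by simp

lemma compact_zono: "compact (zono us)"
proof (induction us)
  case Nil
  then show ?case by (simp add: set_zero)
next
  case (Cons u us)
  have "zono (u # us) = {x + y |x y. x \<in> closed_segment 0 u \<and> y \<in> zono us}"
    by (auto simp: set_plus_def)
  with Cons show ?case
    using compact_sums[of "closed_segment 0 u" "zono us"] by simp
qed

lemma convex_zono: "convex (zono us)"
  by (induction us) (auto intro: convex_set_plus simp: set_zero)

text \<open>Support functions add up under Minkowski sums, and \<open>closed_segment 0 u\<close>
  contributes max(0, z . u), half of z . u + |z . u|. So half of \<open>sum_list us\<close> is the
  centre and \<open>wid us z / 2\<close> the support function about it.\<close>

lemma inner_le_zono:
  "p \<in> zono us \<Longrightarrow> z \<bullet> p \<le> (z \<bullet> sum_list us + wid us z) / 2"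
proof (induction us arbitrary: p)
  case (Cons u us)
  then obtain a q where p: "p = a + q" and a: "a \<in> closed_segment 0 u" and q: "q \<in> zono us"
    by (auto elim: set_plus_elim)
  from a obtain l where l: "a = l *\<^sub>R u" "0 \<le> l" "l \<le> 1"
    by (auto simp: in_segment)
  have "l * (z \<bullet> u) \<le> (z \<bullet> u + \<bar>z \<bullet> u\<bar>) / 2"
    using l mult_left_le_one_le[of "z \<bullet> u" l] mult_nonneg_nonpos[of l "z \<bullet> u"]
    by (cases "z \<bullet> u \<ge> 0") auto
  with Cons.IH[OF q] show ?case
    by (simp add: p l inner_add_right field_simps)
qed (auto simp: set_zero)

lemma zono_attains: "\<exists>p\<in>zono us. z \<bullet> p = (z \<bullet> sum_list us + wid us z) / 2"
proof (induction us)
  case Nil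
  then show ?case by (simp add: set_zero)
next
  case (Cons u us)
  then obtain q where q: "q \<in> zono us" "z \<bullet> q = (z \<bullet> sum_list us + wid us z) / 2" by blast
  define a where "a = (if z \<bullet> u \<ge> 0 then u else 0)"
  have "a + q \<in> zono (u # us)"
    using q by (auto simp: a_def simp del: add_0_left intro!: set_plus_intro)
  moreover have "z \<bullet> (a + q) = (z \<bullet> sum_list (u # us) + wid (u # us) z) / 2"
    using q by (auto simp: a_def inner_add_right field_simps)
  ultimately show ?case by blast
qed

text \<open>A compact convex set is the intersection of its supporting half-planes. Separation
  leaves the zonotope on the larger side, hence the use of \<open>- a\<close>.\<close>

lemma mem_zono_iff:
  "p \<in> zono us \<longleftrightarrow> (\<forall>z. z \<bullet> p \<le> (z \<bullet> sum_list us + wid us z) / 2)"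
proof (intro iffI allI)
  assume R: "\<forall>z. z \<bullet> p \<le> (z \<bullet> sum_list us + wid us z) / 2"
  show "p \<in> zono us"
  proof (rule ccontr)
    assume "p \<notin> zono us"
    then obtain a b where ab: "a \<bullet> p < b" "\<forall>x\<in>zono us. a \<bullet> x > b"
      using separating_hyperplane_closed_point[OF convex_zono compact_imp_closed[OF compact_zono]]
      by metis
    obtain q where "q \<in> zono us" "(- a) \<bullet> q = ((- a) \<bullet> sum_list us + wid us (- a)) / 2"
      using zono_attains by blast
    with ab R[rule_format, of "- a"] show False by force
  qed
qed (rule inner_le_zono)

lemma mem_translate_iff: "p \<in> (+) t ` A \<longleftrightarrow> p - t \<in> (A :: 'a::ab_group_add set)"
  by (auto simp: image_iff intro!: bexI[of _ "p - t"])

lemma lattice_width_le_wid: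
  assumes "z \<in> int_lattice" "z \<noteq> 0"
  shows "lattice_width ((+) t ` zono us) \<le> wid us z"
proof -
  let ?Z = "(+) t ` zono us"
  have ne: "?Z \<noteq> {}" using zono_attains by blast
  have up: "z \<bullet> x \<le> z \<bullet> t + (z \<bullet> sum_list us + wid us z) / 2" if "x \<in> ?Z" for x z
    using that inner_le_zono by (auto simp: inner_add_right)
  have lo: "z \<bullet> t + (z \<bullet> sum_list us - wid us z) / 2 \<le> z \<bullet> x" if "x \<in> ?Z" for x z
    using up[OF that, of "- z"] by (simp add: field_simps)
  have "0 \<le> (SUP x\<in>?Z. z \<bullet> x) - (INF x\<in>?Z. z \<bullet> x)" for z
  proof -
    obtain x where "x \<in> ?Z" using ne by blast
    then have "z \<bullet> x \<le> (SUP x\<in>?Z. z \<bullet> x)" "(INF x\<in>?Z. z \<bullet> x) \<le> z \<bullet> x"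
      by (auto intro!: cSUP_upper cINF_lower bdd_aboveI2[OF up] bdd_belowI2[OF lo])
    then show ?thesis by simp
  qed
  then have "lattice_width ?Z \<le> (SUP x\<in>?Z. z \<bullet> x) - (INF x\<in>?Z. z \<bullet> x)"
    unfolding lattice_width_def using assms by (intro cINF_lower bdd_belowI2[where m = 0]) auto
  also have "\<dots> \<le> (z \<bullet> t + (z \<bullet> sum_list us + wid us z) / 2)
                   - (z \<bullet> t + (z \<bullet> sum_list us - wid us z) / 2)"
    using ne by (intro diff_mono cSUP_least cINF_greatest up lo)
  finally show ?thesis by (simp add: field_simps)
qed

section \<open>Long chords imply covering\<close>

lemma inner_2: "(x :: real ^ 2) \<bullet> y = x $ 1 * y $ 1 + x $ 2 * y $ 2"
  by (simp add: inner_vec_def sum_2)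

lemma int_lattice_2: "(x :: real ^ 2) \<in> int_lattice \<longleftrightarrow> x $ 1 \<in> \<int> \<and> x $ 2 \<in> \<int>"
  by (simp add: int_lattice_def forall_2)

lemma inner_int_lattice:
  "x \<in> int_lattice \<Longrightarrow> y \<in> int_lattice \<Longrightarrow> (x :: real ^ 2) \<bullet> y \<in> \<int>"
  by (simp add: inner_2 int_lattice_2)

definition unimodular_pair :: "real ^ 2 \<Rightarrow> real ^ 2 \<Rightarrow> bool" where
  "unimodular_pair e f \<longleftrightarrow>
     e \<in> int_lattice \<and> f \<in> int_lattice \<and> \<bar>e $ 1 * f $ 2 - e $ 2 * f $ 1\<bar> = 1"

lemma unimodular_pair_change:
  assumes "unimodular_pair e f" and "\<bar>a * d - b * c\<bar> = (1 :: int)"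
  shows "unimodular_pair (of_int a *\<^sub>R e + of_int b *\<^sub>R f) (of_int c *\<^sub>R e + of_int d *\<^sub>R f)"
proof -
  let ?D = "e $ 1 * f $ 2 - e $ 2 * f $ 1"
  have "\<bar>of_int a * of_int d - of_int b * of_int c :: real\<bar> = 1"
    using assms(2) by (metis of_int_1 of_int_abs of_int_diff of_int_mult)
  then have "\<bar>(of_int a * of_int d - of_int b * of_int c) * ?D\<bar> = 1"
    using assms(1) by (simp add: unimodular_pair_def abs_mult)
  moreover have "(of_int a * of_int d - of_int b * of_int c) * ?D =
      (of_int a *\<^sub>R e + of_int b *\<^sub>R f) $ 1 * (of_int c *\<^sub>R e + of_int d *\<^sub>R f) $ 2
    - (of_int a *\<^sub>R e + of_int b *\<^sub>R f) $ 2 * (of_int c *\<^sub>R e + of_int d *\<^sub>R f) $ 1"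
    by (simp add: algebra_simps)
  ultimately show ?thesis
    using assms(1) by (simp add: unimodular_pair_def int_lattice_2)
qed

lemma unimodular_pair_det:
  assumes "unimodular_pair e f"
  shows "(e $ 1 * f $ 2 - e $ 2 * f $ 1) * (e $ 1 * f $ 2 - e $ 2 * f $ 1) = 1"
    and "e $ 1 * f $ 2 - e $ 2 * f $ 1 \<in> \<int>"
  using assms abs_mult_self_eq[of "e $ 1 * f $ 2 - e $ 2 * f $ 1"]
  by (auto simp: unimodular_pair_def int_lattice_2)

text \<open>Cramer's rule: the determinant \<open>D\<close> is 1 or -1, so multiplying by it
  replaces division and keeps coordinates integral.\<close>

lemma unimodular_pair_dual:
  assumes "unimodular_pair e f"
  shows "\<exists>p. e \<bullet> p = a \<and> f \<bullet> p = b \<and> (a \<in> \<int> \<longrightarrow> b \<in> \<int> \<longrightarrow> p \<in> int_lattice)"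
proof -
  define D where "D = e $ 1 * f $ 2 - e $ 2 * f $ 1"
  note D = unimodular_pair_det[OF assms, folded D_def]
  define p :: "real ^ 2" where "p = vector [(a * f $ 2 - b * e $ 2) * D, (b * e $ 1 - a * f $ 1) * D]"
  have "e \<bullet> p = a * (D * (e $ 1 * f $ 2 - e $ 2 * f $ 1))"
       "f \<bullet> p = b * (D * (e $ 1 * f $ 2 - e $ 2 * f $ 1))"
    by (simp_all add: p_def inner_2 algebra_simps)
  then have "e \<bullet> p = a" "f \<bullet> p = b" using D by (simp_all add: D_def)
  moreover have "p \<in> int_lattice" if "a \<in> \<int>" "b \<in> \<int>"
    using that assms D(2) by (simp add: p_def int_lattice_2 unimodular_pair_def)
  ultimately show ?thesis by blast
qed

lemma unimodular_pair_span:
  assumes "unimodular_pair e f"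
  shows "\<exists>a b. z = a *\<^sub>R e + b *\<^sub>R f"
proof -
  define D where "D = e $ 1 * f $ 2 - e $ 2 * f $ 1"
  note D = unimodular_pair_det[OF assms, folded D_def]
  define a b where "a = D * (z $ 1 * f $ 2 - z $ 2 * f $ 1)" and "b = D * (e $ 1 * z $ 2 - e $ 2 * z $ 1)"
  have "(a *\<^sub>R e + b *\<^sub>R f) $ 1 = z $ 1 * (D * (e $ 1 * f $ 2 - e $ 2 * f $ 1))"
       "(a *\<^sub>R e + b *\<^sub>R f) $ 2 = z $ 2 * (D * (e $ 1 * f $ 2 - e $ 2 * f $ 1))"
    by (simp_all add: a_def b_def algebra_simps)
  then have "z = a *\<^sub>R e + b *\<^sub>R f" using D by (simp add: D_def vec_eq_iff forall_2)
  then show ?thesis by blast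
qed

text \<open>
  The inequality says that the chords of the centred half zonotope at \<open>e \<bullet> x = \<plusminus>1/2\<close> have length
  at least 1: the upper end of the right chord is \<open>inf (G(s)/4 - s/2)\<close>, where
  \<open>G(s) = wid us (f + s *\<^sub>R e)\<close>, and its lower end is \<open>sup (- s/2 - G(s)/4)\<close>.
\<close>
definition long_chords :: "(real ^ 2) list \<Rightarrow> real ^ 2 \<Rightarrow> real ^ 2 \<Rightarrow> bool" where
  "long_chords us e f \<longleftrightarrow> 2 \<le> wid us e \<and>
     (\<forall>s s'. 4 + 2 * (s - s') \<le> wid us (f + s *\<^sub>R e) + wid us (f + s' *\<^sub>R e))"

text \<open>In the coordinates (e . x, f . x), the half zonotope centred at the origin contains all
  points (h, 2 h y + d) with |h|, |d| \<le> 1/2. The integer translates of this parallelogram cover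
  the plane.\<close>

lemma long_chords_covers:
  assumes ef: "unimodular_pair e f" and ch: "long_chords us e f"
  shows "(\<lambda>x. (1 / 2) *\<^sub>R x) ` ((+) t ` zono us) + int_lattice = UNIV"
proof -
  define G where "G s = wid us (f + s *\<^sub>R e)" for s
  \<comment> \<open>\<open>y\<close> lies 1/2 above the lower end of the right chord, which
    therefore contains the unit segment centred at \<open>y\<close>; by symmetry the left chord
    contains the one centred at \<open>- y\<close>.\<close>
  define y where "y = (SUP s. 1 / 2 - s / 2 - G s / 4)"
  have G: "4 + 2 * (s - s') \<le> G s + G s'" for s s'
    using ch by (auto simp: long_chords_def G_def)
  have G': "1 / 2 - s' / 2 - G s' / 4 \<le> G s / 4 - s / 2 - 1 / 2" for s s'
    using G[of s s'] by argo
  have y1: "s / 2 + y + 1 / 2 \<le> G s / 4" for s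
  proof -
    have "y \<le> G s / 4 - s / 2 - 1 / 2"
      unfolding y_def using G' by (intro cSUP_least) blast+
    then show ?thesis by argo
  qed
  have y2: "- (s / 2 + y - 1 / 2) \<le> G s / 4" for s
  proof -
    have "1 / 2 - s / 2 - G s / 4 \<le> y"
      unfolding y_def using G' by (intro cSUP_upper bdd_aboveI2) blast+
    then show ?thesis by argo
  qed
  have corner: "\<bar>a / 2 + b * (y + d)\<bar> \<le> wid us (a *\<^sub>R e + b *\<^sub>R f) / 4" if d: "\<bar>d\<bar> = 1 / 2" for a b d
  proof (cases "b = 0")
    case True
    \<comment> \<open>Multiples of \<open>e\<close> only test whether the body reaches the lines e .
      x = 1/2 and e . x = -1/2.\<close>
    have "\<bar>a\<bar> * 2 \<le> \<bar>a\<bar> * wid us e"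
      using ch by (intro mult_left_mono) (auto simp: long_chords_def)
    with True show ?thesis by simp
  next
    case False
    have "\<bar>(a / b) / 2 + y + d\<bar> \<le> G (a / b) / 4"
      using y1[of "a / b"] y2[of "a / b"] d by linarith
    then have "\<bar>b\<bar> * \<bar>(a / b) / 2 + y + d\<bar> \<le> \<bar>b\<bar> * (G (a / b) / 4)"
      by (intro mult_left_mono) auto
    moreover have "\<bar>b\<bar> * \<bar>(a / b) / 2 + y + d\<bar> = \<bar>a / 2 + b * (y + d)\<bar>"
    proof -
      have "b * ((a / b) / 2 + y + d) = a / 2 + b * (y + d)" using False by (simp add: field_simps)
      then show ?thesis by (simp flip: abs_mult)
    qed
    moreover have "\<bar>b\<bar> * G (a / b) = wid us (a *\<^sub>R e + b *\<^sub>R f)"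
      unfolding G_def wid_scaleR[symmetric] using False by (simp add: algebra_simps)
    ultimately show ?thesis by simp
  qed
  have para: "a * h + b * (2 * h * y + d) \<le> wid us (a *\<^sub>R e + b *\<^sub>R f) / 4"
    if "\<bar>h\<bar> \<le> 1 / 2" "\<bar>d\<bar> \<le> 1 / 2" for a b h d
  proof -
    let ?W = "wid us (a *\<^sub>R e + b *\<^sub>R f) / 4"
    \<comment> \<open>The point is a combination of the corners (1/2, y + 1/2) and (1/2, y - 1/2)
      with weights h + d and h - d, whose absolute values add up to at most 1.\<close>
    have "a * h + b * (2 * h * y + d)
        = (h + d) * (a / 2 + b * (y + 1 / 2)) + (h - d) * (a / 2 + b * (y + - 1 / 2))"
      by (simp add: field_simps)
    also have "\<dots> \<le> \<bar>h + d\<bar> * \<bar>a / 2 + b * (y + 1 / 2)\<bar> + \<bar>h - d\<bar> * \<bar>a / 2 + b * (y + - 1 / 2)\<bar>"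
      by (intro add_mono) (metis abs_ge_self abs_mult)+
    also have "\<dots> \<le> \<bar>h + d\<bar> * ?W + \<bar>h - d\<bar> * ?W"
      by (intro add_mono mult_left_mono corner) auto
    also have "\<dots> = (\<bar>h + d\<bar> + \<bar>h - d\<bar>) * ?W" by (simp add: algebra_simps)
    also have "\<dots> \<le> 1 * ?W" using that by (intro mult_right_mono) auto
    finally show ?thesis by simp
  qed
  have "x \<in> (\<lambda>x. (1 / 2) *\<^sub>R x) ` ((+) t ` zono us) + int_lattice" for x
  proof -
    \<comment> \<open>\<open>p\<close> is \<open>x\<close> relative to the centre of the half
      zonotope. Its f-coordinate is rounded only after subtracting the slanted midline
      \<open>2 * h * y\<close>.\<close>
    define p where "p = x - (1 / 2) *\<^sub>R (t + (1 / 2) *\<^sub>R sum_list us)"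
    define k where "k = round (e \<bullet> p)"
    define h where "h = e \<bullet> p - of_int k"
    define m where "m = round (f \<bullet> p - 2 * h * y)"
    define d where "d = f \<bullet> p - 2 * h * y - of_int m"
    obtain l where l: "e \<bullet> l = of_int k" "f \<bullet> l = of_int m" "l \<in> int_lattice"
      using unimodular_pair_dual[OF ef, of "of_int k" "of_int m"] by auto
    define q where "q = 2 *\<^sub>R (p - l) + (1 / 2) *\<^sub>R sum_list us"
    have hd: "\<bar>h\<bar> \<le> 1 / 2" "\<bar>d\<bar> \<le> 1 / 2"
      using of_int_round_abs_le[of "e \<bullet> p"] of_int_round_abs_le[of "f \<bullet> p - 2 * h * y"]
      by (simp_all add: h_def d_def k_def m_def abs_minus_commute)
    have le: "z \<bullet> (p - l) \<le> wid us z / 4" for z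
    proof -
      obtain a b where z: "z = a *\<^sub>R e + b *\<^sub>R f" using unimodular_pair_span[OF ef] by blast
      have "z \<bullet> (p - l) = a * h + b * (2 * h * y + d)"
        by (simp add: z inner_add_left inner_diff_right l h_def d_def algebra_simps)
      with para[OF hd] show ?thesis by (simp add: z)
    qed
    have "z \<bullet> q = 2 * (z \<bullet> (p - l)) + (z \<bullet> sum_list us) / 2" for z
      unfolding q_def inner_add_right inner_scaleR_right by simp
    then have "z \<bullet> q \<le> (z \<bullet> sum_list us + wid us z) / 2" for z
      using le[of z] by (simp add: field_simps del: inner_diff_right)
    then have "q \<in> zono us" by (simp add: mem_zono_iff)
    moreover have "x = (1 / 2) *\<^sub>R (t + q) + l"
      by (simp add: q_def p_def algebra_simps)
    ultimately show ?thesis using l by (auto intro!: set_plus_intro)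
  qed
  then show ?thesis by blast
qed

section \<open>Minimal width at least four\<close>

text \<open>An integer lies between the two points, at distances \<open>p\<close> and
  \<open>q\<close>, where \<open>G\<close> takes the values \<open>X\<close> and \<open>Y\<close>.
  Adding p - q times a p \<le> X to the convexity inequality gives \<open>X\<close> and
  \<open>Y\<close> the same coefficient \<open>p\<close>.\<close>

lemma chord_inequality_single_integer:
  fixes a p q X Y :: real
  assumes a: "4 \<le> a" and pq: "0 \<le> q" "q \<le> p" "p \<le> 1" and X: "a * p \<le> X" and Y: "a \<le> Y \<or> 0 < p"
    and conv: "a * (p + q) \<le> q * X + p * Y" and base: "a \<le> X \<or> 0 < p"
  shows "4 + 2 * (p + q) \<le> X + Y"
proof (cases "p = 0")
  case True
  with assms show ?thesis by auto
next
  case False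
  with pq have p: "0 < p" by simp
  have "(p - q) * (a * p) \<le> (p - q) * X"
    using X pq by (intro mult_left_mono) auto
  with conv have "a * ((p + q) + (p - q) * p) \<le> p * (X + Y)"
    by (simp add: algebra_simps)
  moreover have "4 * ((p + q) + (p - q) * p) \<le> a * ((p + q) + (p - q) * p)"
    using a pq by (intro mult_right_mono) auto
  moreover have "p * (4 + 2 * (p + q)) \<le> 4 * ((p + q) + (p - q) * p)"
  proof -
    have "0 \<le> 4 * (q * (1 - p)) + 2 * (p * (p - q))"
      using pq by (intro add_nonneg_nonneg mult_nonneg_nonneg) auto
    then show ?thesis by (simp add: algebra_simps)
  qed
  ultimately have "p * (4 + 2 * (p + q)) \<le> p * (X + Y)" by linarith
  with p show ?thesis by (simp add: mult_le_cancel_left_pos)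
qed

text \<open>Applied with \<^term>\<open>G s = wid us (f + s *\<^sub>R e)\<close> and \<^term>\<open>a = wid us e\<close>.\<close>
lemma chord_inequality:
  fixes G :: "real \<Rightarrow> real"
  assumes a: "4 \<le> a"
    and conv: "\<And>x y w. x \<le> y \<Longrightarrow> y \<le> w \<Longrightarrow> (w - x) * G y \<le> (w - y) * G x + (y - x) * G w"
    and lip: "\<And>x y. G x \<le> G y + a * \<bar>x - y\<bar>"
    and far: "\<And>x y. a * \<bar>x - y\<bar> \<le> G x + G y"
    and int: "\<And>k::int. a \<le> G (of_int k)"
    and le: "s' \<le> s"
  shows "4 + 2 * (s - s') \<le> G s + G s'"
proof -
  define k where "k = \<lceil>s'\<rceil>"
  define q where "q = of_int k - s'"
  define p where "p = s - of_int k"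
  have q: "0 \<le> q" "q < 1" unfolding q_def k_def by linarith+
  have d: "s - s' = p + q" by (simp add: p_def q_def)
  have s: "s = of_int k + p" "s' = of_int k - q" by (simp_all add: p_def q_def)
  have Gk: "a \<le> G (of_int k)" "a \<le> G (of_int k + 1)" "a \<le> G (of_int k - 1)"
    using int[of k] int[of "k+1"] int[of "k-1"] by simp_all
  \<comment> \<open>No integer between \<open>s'\<close> and \<open>s\<close>; \<open>k\<close> with
    \<open>s\<close> at most 1 beyond it; both \<open>k\<close> and \<open>k + 1\<close> with
    distance at most 2; distance at least 2. In the third case 2 a \<ge> 8 suffices, in the fourth
    the bound \<open>far\<close>.\<close>
  consider "p < 0" | "0 \<le> p" "p \<le> 1" | "1 < p" "p + q \<le> 2" | "2 \<le> p + q" by linarith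
  then show ?thesis
  proof cases
    case 1
    have "a \<le> G s + a * (-p)" using lip[of "of_int k" s] Gk 1 by (simp add: s)
    moreover have "a \<le> G s' + a * (1 - q)" using lip[of "of_int k - 1" s'] Gk q by (simp add: s)
    ultimately have "a + a * (p + q) \<le> G s + G s'" by (simp add: algebra_simps)
    moreover have "4 * (p + q) \<le> a * (p + q)" using a le d by (intro mult_right_mono) auto
    ultimately have "4 + 4 * (p + q) \<le> G s + G s'" using a by linarith
    then show ?thesis using d le by argo
  next
    case 2
    have "a \<le> G s + a * (1 - p)" using lip[of "of_int k + 1" s] Gk 2 by (simp add: s)
    then have X: "a * p \<le> G s" by (simp add: algebra_simps)
    have "a \<le> G s' + a * (1 - q)" using lip[of "of_int k - 1" s'] Gk q by (simp add: s)
    then have Y: "a * q \<le> G s'" by (simp add: algebra_simps)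
    have "(p + q) * a \<le> (p + q) * G (of_int k)" using Gk 2 q by (intro mult_left_mono) auto
    also have "\<dots> \<le> p * G s' + q * G s"
      using conv[of s' "of_int k" s] 2 q by (simp add: s algebra_simps)
    finally have C: "a * (p + q) \<le> p * G s' + q * G s" by (simp add: algebra_simps)
    consider "p = 0" "q = 0" | "0 < p" "q \<le> p" | "0 < q" "p \<le> q" using 2 q by linarith
    then show ?thesis
    proof cases
      case 1
      then show ?thesis using Gk a by (simp add: s)
    next
      case 2
      then show ?thesis
        using chord_inequality_single_integer[where a = a and p = p and q = q and X = "G s" and Y = "G s'"]
          a q \<open>p \<le> 1\<close> X C d by auto
    next
      case 3
      then show ?thesis
        using chord_inequality_single_integer[where a = a and p = q and q = p and X = "G s'" and Y = "G s"]
          a q \<open>0 \<le> p\<close> Y C d by (auto simp: add.commute)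
    qed
  next
    case 3
    define r where "r = p - 1"
    have r: "0 \<le> r" "r \<le> 1" "s = of_int k + 1 + r" using 3 q by (auto simp: r_def s)
    have pos: "0 < 1 + r + q" using r q by simp
    have "(1 + r + q) * a \<le> (1 + r + q) * G (of_int k)" using Gk pos by simp
    also have "\<dots> \<le> (1 + r) * G s' + q * G s"
      using conv[of s' "of_int k" s] r q by (simp add: s algebra_simps)
    finally have A: "(1 + r + q) * a \<le> (1 + r) * G s' + q * G s" .
    have "(1 + r + q) * a \<le> (1 + r + q) * G (of_int k + 1)" using Gk pos by simp
    also have "\<dots> \<le> r * G s' + (1 + q) * G s"
      using conv[of s' "of_int k + 1" s] r q by (simp add: s algebra_simps)
    finally have B: "(1 + r + q) * a \<le> r * G s' + (1 + q) * G s" .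
    \<comment> \<open>weights chosen so that \<open>G s\<close> and \<open>G s'\<close> get the same coefficient \<open>1 + r + q\<close>\<close>
    have "(1 + q - r) * ((1 + r + q) * a) + (1 + r - q) * ((1 + r + q) * a)
        \<le> (1 + q - r) * ((1 + r) * G s' + q * G s) + (1 + r - q) * (r * G s' + (1 + q) * G s)"
      using A B r q by (intro add_mono mult_left_mono) auto
    then have "(1 + r + q) * (2 * a) \<le> (1 + r + q) * (G s + G s')"
      by (simp add: algebra_simps)
    with pos have "2 * a \<le> G s + G s'" by (simp add: mult_le_cancel_left_pos)
    with a 3 d show ?thesis by argo
  next
    case 4
    have "4 * (p + q) \<le> a * (p + q)" using a 4 by (intro mult_right_mono) auto
    also have "\<dots> \<le> G s + G s'" using far[of s s'] 4 d by simp
    finally show ?thesis using 4 d by argo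
  qed
qed

lemma wid_int:
  assumes "set us \<subseteq> int_lattice" "z \<in> int_lattice"
  shows "wid us z \<in> \<int>"
  using assms by (induction us) (auto intro!: Ints_add Ints_abs inner_int_lattice)

lemma ex_minimal_pair:
  assumes us: "set us \<subseteq> int_lattice"
  shows "\<exists>e f. unimodular_pair e f \<and> (\<forall>e' f'. unimodular_pair e' f' \<longrightarrow> wid us e \<le> wid us e')"
proof -
  define P where "P e \<longleftrightarrow> (\<exists>f. unimodular_pair e f)" for e
  have "unimodular_pair (vector [1, 0]) (vector [0, 1])"
    by (simp add: unimodular_pair_def int_lattice_2)
  then have "P (vector [1, 0])" by (auto simp: P_def)
  then obtain e where e: "P e" "\<And>e'. P e' \<Longrightarrow> nat \<lfloor>wid us e\<rfloor> \<le> nat \<lfloor>wid us e'\<rfloor>"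
    using ex_has_least_nat[of P _ "\<lambda>e. nat \<lfloor>wid us e\<rfloor>"] by blast
  have "wid us e \<le> wid us e'" if "P e'" for e'
  proof -
    have "wid us e \<in> \<int>" "wid us e' \<in> \<int>"
      using that e(1) us by (auto simp: P_def unimodular_pair_def intro!: wid_int)
    moreover have "\<lfloor>wid us e\<rfloor> \<le> \<lfloor>wid us e'\<rfloor>"
      using e(2)[OF that] by (simp add: nat_le_eq_zle)
    ultimately show ?thesis by (auto elim!: Ints_cases)
  qed
  with e(1) show ?thesis by (auto simp: P_def)
qed

text \<open>Convexity, the Lipschitz bound and the growth bound come from the triangle inequality
  for \<open>wid\<close>. The bound at integers is minimality of \<open>e\<close> against the basis
  vectors f + k e.\<close>

lemma long_chords_minimal:
  assumes ef: "unimodular_pair e f" and a: "4 \<le> wid us e"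
    and min: "\<And>e' f'. unimodular_pair e' f' \<Longrightarrow> wid us e \<le> wid us e'"
  shows "long_chords us e f"
proof -
  define G where "G s = wid us (f + s *\<^sub>R e)" for s
  have conv: "(w - x) * G y \<le> (w - y) * G x + (y - x) * G w" if "x \<le> y" "y \<le> w" for x y w
  proof -
    have "(w - x) *\<^sub>R (f + y *\<^sub>R e) = (w - y) *\<^sub>R (f + x *\<^sub>R e) + (y - x) *\<^sub>R (f + w *\<^sub>R e)"
      by (simp add: algebra_simps)
    then have "wid us ((w - x) *\<^sub>R (f + y *\<^sub>R e))
        \<le> wid us ((w - y) *\<^sub>R (f + x *\<^sub>R e)) + wid us ((y - x) *\<^sub>R (f + w *\<^sub>R e))"
      using wid_triangle by metis
    then show ?thesis using that by (simp add: G_def)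
  qed
  have lip: "G x \<le> G y + wid us e * \<bar>x - y\<bar>" for x y
    using wid_triangle[of us "f + y *\<^sub>R e" "(x - y) *\<^sub>R e"] unfolding wid_scaleR
    by (simp add: G_def algebra_simps)
  have far: "wid us e * \<bar>x - y\<bar> \<le> G x + G y" for x y
    using wid_triangle[of us "f + x *\<^sub>R e" "- (f + y *\<^sub>R e)"] wid_scaleR[of us "x - y" e]
    unfolding wid_minus by (simp add: G_def algebra_simps)
  have int: "wid us e \<le> G (of_int k)" for k
    using min[OF unimodular_pair_change[OF ef, of k 0 1 1]] by (simp add: G_def algebra_simps)
  have ord: "4 + 2 * (s - s') \<le> G s + G s'" if "s' \<le> s" for s s'
    using chord_inequality[of "wid us e" G s' s] a conv lip far int that by blast
  have "4 + 2 * (s - s') \<le> G s + G s'" for s s'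
    using ord[of s' s] ord[of s s'] by argo
  with a show ?thesis by (simp add: long_chords_def G_def)
qed

section \<open>Minimal width three\<close>

definition covering_pair :: "(real ^ 2) list \<Rightarrow> bool" where
  "covering_pair us \<longleftrightarrow> (\<exists>e f. unimodular_pair e f \<and> long_chords us e f)"

text \<open>The right-hand side is the width function of the generators (1, 0) and (2, 5) of
  \<open>P25\<close>, with \<alpha> and \<beta> as coordinates.\<close>

definition P25_pair :: "(real ^ 2) list \<Rightarrow> bool" where
  "P25_pair us \<longleftrightarrow> (\<exists>e f. unimodular_pair e f \<and>
     (\<forall>\<alpha> \<beta> :: real. wid us (\<alpha> *\<^sub>R e + \<beta> *\<^sub>R f) = \<bar>\<alpha>\<bar> + \<bar>2 * \<alpha> + 5 * \<beta>\<bar>))"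

text \<open>The new basis is \<open>a e + b f\<close>, \<open>c e + d f\<close>.\<close>
lemma covering_pairI:
  fixes a b c d :: int and F :: "real \<Rightarrow> real \<Rightarrow> real"
  assumes "unimodular_pair e f" and W: "\<And>\<alpha> \<beta> :: real. wid us (\<alpha> *\<^sub>R e + \<beta> *\<^sub>R f) = F \<alpha> \<beta>"
    and "\<bar>a * d - b * c\<bar> = 1" and "2 \<le> F a b"
    and F: "\<And>(s::real) (s'::real). 4 + 2 * (s - s') \<le> F (c + s * a) (d + s * b) + F (c + s' * a) (d + s' * b)"
  shows "covering_pair us"
proof -
  have "wid us ((of_int c *\<^sub>R e + of_int d *\<^sub>R f) + s *\<^sub>R (of_int a *\<^sub>R e + of_int b *\<^sub>R f))
      = F (c + s * a) (d + s * b)" for s :: real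
    unfolding W[symmetric] by (simp add: algebra_simps)
  then have "long_chords us (of_int a *\<^sub>R e + of_int b *\<^sub>R f) (of_int c *\<^sub>R e + of_int d *\<^sub>R f)"
    using assms by (simp add: long_chords_def)
  then show ?thesis
    using unimodular_pair_change[OF assms(1,3)] by (auto simp: covering_pair_def)
qed

text \<open>For G(s) = c + |s| + |s + q| + |s + r|, the minimum of G(s) - 2 s is c + q + r, at s =
  0, and that of G(s') + 2 s' is c - q, at s' = - r. So the chord inequality for \<open>e\<close>
  and \<open>f\<close> amounts to 2 c + r \<ge> 4.\<close>

lemma three_unit_forms:
  fixes c q r :: int
  assumes ef: "unimodular_pair e f" and c: "0 \<le> c" and qr: "0 \<le> q" "q \<le> r"
    and W: "\<And>\<alpha> \<beta> :: real. wid us (\<alpha> *\<^sub>R e + \<beta> *\<^sub>R f) =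
              c * \<bar>\<beta>\<bar> + \<bar>\<alpha>\<bar> + \<bar>\<alpha> + \<beta> * q\<bar> + \<bar>\<alpha> + \<beta> * r\<bar>"
    and min: "3 \<le> wid us (of_int (- q) *\<^sub>R e + 1 *\<^sub>R f)"
  shows "covering_pair us"
proof (cases "4 \<le> 2 * c + r")
  case True
  then have "4 \<le> 2 * real_of_int c + real_of_int r" by linarith
  then show ?thesis
    by (intro covering_pairI[where a = 1 and b = 0 and c = 0 and d = 1, OF ef W]) simp_all
next
  case False
  have "c + r \<ge> 3" using min[unfolded W] qr by simp
  with False c have cr: "c = 0" "r = 3" by linarith+
  \<comment> \<open>Four forms remain, with q and 3 - q mirror images of each other. The new first
    basis vectors have widths 3, 4, 4, 3, so the middle cases give up minimality.\<close>
  from qr cr consider "q = 0" | "q = 1" | "q = 2" | "q = 3" by linarith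
  then show ?thesis
  proof cases
    case 1
    then show ?thesis
      using cr by (intro covering_pairI[where a = 0 and b = 1 and c = 1 and d = 0, OF ef W]) simp_all
  next
    case 2
    then show ?thesis
      using cr by (intro covering_pairI[where a = 2 and b = "-1" and c = 1 and d = "-1", OF ef W]) simp_all
  next
    case 3
    then show ?thesis
      using cr by (intro covering_pairI[where a = "-1" and b = 1 and c = "-2" and d = 1, OF ef W]) simp_all
  next
    case 4
    then show ?thesis
      using cr by (intro covering_pairI[where a = "-3" and b = 1 and c = 1 and d = 0, OF ef W]) simp_all
  qed
qed

text \<open>Minimising as for three unit forms, now at s = 0 and s' = - p / 2, turns the chord
  inequality for \<open>e\<close> and \<open>f\<close> into 4 c + p \<ge> 8.\<close>

lemma double_and_unit_form:
  fixes c p :: int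
  assumes ef: "unimodular_pair e f" and c: "0 \<le> c" and p: "odd p" "0 \<le> p"
    and W: "\<And>\<alpha> \<beta> :: real. wid us (\<alpha> *\<^sub>R e + \<beta> *\<^sub>R f) =
              c * \<bar>\<beta>\<bar> + \<bar>2 * \<alpha> + \<beta> * p\<bar> + \<bar>\<alpha>\<bar>"
    and min: "\<And>k::int. 3 \<le> wid us (of_int k *\<^sub>R e + 1 *\<^sub>R f)"
  shows "covering_pair us \<or> P25_pair us"
proof -
  obtain m where m: "p = 2 * m + 1" using p by (auto elim: oddE)
  then have m0: "0 \<le> m" using p by simp
  consider "8 \<le> 4 * c + p" | "c = 0" "p = 5" | "c = 0" "p = 7" | "c = 1" "p = 3"
  proof -
    \<comment> \<open>At k = - m the doubled form has absolute value 1. With 4 c + p < 8 the bound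
      leaves three pairs, of which c = 0, p = 5 is \<open>P25\<close>.\<close>
    have "3 \<le> c + 1 + m" using min[of "- m", unfolded W] m0 by (simp add: m)
    then have "8 \<le> 4 * c + p \<or> c = 0 \<and> p = 5 \<or> c = 0 \<and> p = 7 \<or> c = 1 \<and> p = 3"
      using m c m0 by presburger
    then show thesis using that by blast
  qed
  then show ?thesis
  proof cases
    case 1
    then have "8 \<le> 4 * real_of_int c + real_of_int p" by linarith
    then have "covering_pair us"
      by (intro covering_pairI[where a = 1 and b = 0 and c = 0 and d = 1, OF ef W]) simp_all
    then show ?thesis ..
  next
    case 2
    then have "P25_pair us"
      unfolding P25_pair_def W using ef 2
      by (intro exI[of _ e] exI[of _ f]) (simp add: W add.commute mult.commute)
    then show ?thesis ..
  next
    case 3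
    then have "covering_pair us"
      by (intro covering_pairI[where a = 3 and b = "-1" and c = 1 and d = 0, OF ef W]) simp_all
    then show ?thesis ..
  next
    case 4
    then have "covering_pair us"
      by (intro covering_pairI[where a = 2 and b = "-1" and c = 1 and d = 0, OF ef W]) simp_all
    then show ?thesis ..
  qed
qed

text \<open>Rounding - p / 3 to the nearest integer \<open>k\<close> bounds the tripled form by 1,
  so c \<ge> 2. Both minima in the chord inequality lie at - p / 3, so it reads 2 c \<ge> 4.\<close>

lemma triple_form:
  fixes c p :: int
  assumes ef: "unimodular_pair e f"
    and W: "\<And>\<alpha> \<beta> :: real. wid us (\<alpha> *\<^sub>R e + \<beta> *\<^sub>R f) =
              c * \<bar>\<beta>\<bar> + \<bar>3 * \<alpha> + \<beta> * p\<bar>"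
    and min: "\<And>k::int. 3 \<le> wid us (of_int k *\<^sub>R e + 1 *\<^sub>R f)"
  shows "covering_pair us"
proof -
  define k where "k = - ((p + 1) div 3)"
  have "\<bar>3 * k + p\<bar> \<le> 1" unfolding k_def by presburger
  then have "\<bar>3 * real_of_int k + real_of_int p\<bar> \<le> 1" by linarith
  with min[of k, unfolded W] have "2 \<le> c" by simp
  then show ?thesis
    by (intro covering_pairI[where a = 1 and b = 0 and c = 0 and d = 1, OF ef W]) simp_all
qed

text \<open>A generator may be replaced by its negative, which makes its e-coordinate positive;
  generators orthogonal to \<open>e\<close> see only \<beta> and are collected in
  \<open>c\<close>.\<close>

lemma wid_normal_form:
  assumes "set us \<subseteq> int_lattice" and "unimodular_pair e f"
  shows "\<exists>(c::int) (vs::(int \<times> int) list). (0::int) \<le> c \<and> (\<forall>v\<in>set vs. 0 < fst v) \<and>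
    (\<forall>\<alpha> \<beta> :: real. wid us (\<alpha> *\<^sub>R e + \<beta> *\<^sub>R f) =
      c * \<bar>\<beta>\<bar> + (\<Sum>v\<leftarrow>vs. \<bar>\<alpha> * real_of_int (fst v) + \<beta> * real_of_int (snd v)\<bar>))"
  using assms(1)
proof (induction us)
  case Nil
  show ?case by (intro exI[of _ 0] exI[of _ "[]"]) simp
next
  case (Cons u us)
  then obtain c :: int and vs :: "(int \<times> int) list" where IH: "(0::int) \<le> c" "\<forall>v\<in>set vs. 0 < fst v"
    "\<And>\<alpha> \<beta> :: real. wid us (\<alpha> *\<^sub>R e + \<beta> *\<^sub>R f) =
      c * \<bar>\<beta>\<bar> + (\<Sum>v\<leftarrow>vs. \<bar>\<alpha> * real_of_int (fst v) + \<beta> * real_of_int (snd v)\<bar>)"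
    by auto
  have "e \<bullet> u \<in> \<int>" "f \<bullet> u \<in> \<int>"
    using Cons.prems assms(2) by (auto simp: unimodular_pair_def intro!: inner_int_lattice)
  then obtain x y where xy: "e \<bullet> u = of_int x" "f \<bullet> u = of_int y" by (auto elim!: Ints_cases)
  have step: "wid (u # us) (\<alpha> *\<^sub>R e + \<beta> *\<^sub>R f)
      = \<bar>\<alpha> * x + \<beta> * y\<bar> + (c * \<bar>\<beta>\<bar> + (\<Sum>v\<leftarrow>vs. \<bar>\<alpha> * real_of_int (fst v) + \<beta> * real_of_int (snd v)\<bar>))" for \<alpha> \<beta> :: real
    by (simp add: IH inner_add_left xy)
  consider "x = 0" | "0 < x" | "x < 0" by linarith
  then show ?case
  proof cases
    case 1
    then show ?thesis using IH(1,2)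
      by (intro exI[of _ "c + \<bar>y\<bar>"] exI[of _ vs]) (simp only: step, simp add: algebra_simps abs_mult)
  next
    case 2
    then show ?thesis using IH(1,2)
      by (intro exI[of _ c] exI[of _ "(x, y) # vs"]) (simp only: step, simp)
  next
    case 3
    have "\<bar>\<alpha> * x + \<beta> * y\<bar> = \<bar>\<alpha> * of_int (- x) + \<beta> * of_int (- y)\<bar>" for \<alpha> \<beta> :: real
      by simp
    with 3 show ?thesis using IH(1,2)
      by (intro exI[of _ c] exI[of _ "(- x, - y) # vs"]) (simp only: step, simp)
  qed
qed

lemma positive_sum_three_cases:
  fixes vs :: "(int \<times> int) list"
  assumes "\<forall>v\<in>set vs. 0 < fst v" "(\<Sum>v\<leftarrow>vs. fst v) = 3"
  shows "(\<exists>p. vs = [(3, p)]) \<or> (\<exists>p q. vs = [(2, p), (1, q)]) \<or> (\<exists>p q. vs = [(1, q), (2, p)])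
    \<or> (\<exists>p q r. vs = [(1, p), (1, q), (1, r)])"
proof -
  have nonneg: "0 \<le> (\<Sum>v\<leftarrow>ws. fst v)" if "\<forall>v\<in>set ws. 0 < fst v" for ws :: "(int \<times> int) list"
    using that by (induction ws) force+
  obtain v1 ws1 where 1: "vs = v1 # ws1" using assms by (cases vs) auto
  show ?thesis
  proof (cases ws1)
    case Nil
    then show ?thesis using assms 1 by (cases v1) auto
  next
    case 2: (Cons v2 ws2)
    show ?thesis
    proof (cases ws2)
      case Nil
      with assms 1 2 have "0 < fst v1" "0 < fst v2" "fst v1 + fst v2 = 3" by auto
      then have "fst v1 = 1 \<and> fst v2 = 2 \<or> fst v1 = 2 \<and> fst v2 = 1" by linarith
      then show ?thesis using 1 2 Nil by (cases v1; cases v2) auto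
    next
      case 3: (Cons v3 ws3)
      have pos: "0 < fst v1" "0 < fst v2" "0 < fst v3" "0 \<le> (\<Sum>v\<leftarrow>ws3. fst v)"
        using assms(1) 1 2 3 nonneg[of ws3] by auto
      have sum: "fst v1 + fst v2 + fst v3 + (\<Sum>v\<leftarrow>ws3. fst v) = 3"
        using assms(2) 1 2 3 by simp
      have "fst v1 = 1" "fst v2 = 1" "fst v3 = 1" "(\<Sum>v\<leftarrow>ws3. fst v) = 0"
        using pos sum by linarith+
      moreover have "ws3 = []"
      proof (cases ws3)
        case (Cons v4 ws4)
        then have "0 < fst v4" "0 \<le> (\<Sum>v\<leftarrow>ws4. fst v)"
          using assms(1) 1 2 3 nonneg[of ws4] by auto
        with Cons \<open>(\<Sum>v\<leftarrow>ws3. fst v) = 0\<close> show ?thesis by simp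
      qed
      ultimately show ?thesis using 1 2 3 by (cases v1; cases v2; cases v3) auto
    qed
  qed
qed

lemma unimodular_pair_shear:
  assumes "unimodular_pair e f"
  shows "unimodular_pair e (f - of_int p *\<^sub>R e)" "unimodular_pair (of_int p *\<^sub>R e + f) e"
  using unimodular_pair_change[OF assms, of 1 1 0 "- p"] unimodular_pair_change[OF assms, of p 0 1 1]
  by simp_all

lemma three_unit_forms_sorted:
  fixes c p q r :: int
  assumes ef: "unimodular_pair e f" and c: "0 \<le> c" and pqr: "p \<le> q" "q \<le> r"
    and W: "\<And>\<alpha> \<beta> :: real. wid us (\<alpha> *\<^sub>R e + \<beta> *\<^sub>R f)
              = c * \<bar>\<beta>\<bar> + \<bar>\<alpha> + \<beta> * p\<bar> + \<bar>\<alpha> + \<beta> * q\<bar> + \<bar>\<alpha> + \<beta> * r\<bar>"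
    and min: "\<And>e f. unimodular_pair e f \<Longrightarrow> 3 \<le> wid us e"
  shows "covering_pair us"
proof (rule three_unit_forms[where c = c and q = "q - p" and r = "r - p"])
  show ef': "unimodular_pair e (f - of_int p *\<^sub>R e)" by (rule unimodular_pair_shear[OF ef])
  show "wid us (\<alpha> *\<^sub>R e + \<beta> *\<^sub>R (f - of_int p *\<^sub>R e))
      = c * \<bar>\<beta>\<bar> + \<bar>\<alpha>\<bar> + \<bar>\<alpha> + \<beta> * of_int (q - p)\<bar> + \<bar>\<alpha> + \<beta> * of_int (r - p)\<bar>" for \<alpha> \<beta> :: real
  proof -
    have "\<alpha> *\<^sub>R e + \<beta> *\<^sub>R (f - of_int p *\<^sub>R e) = (\<alpha> - \<beta> * p) *\<^sub>R e + \<beta> *\<^sub>R f"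
      by (simp add: algebra_simps)
    then show ?thesis using W[of "\<alpha> - \<beta> * p" \<beta>] by (simp add: algebra_simps)
  qed
  show "3 \<le> wid us (of_int (- (q - p)) *\<^sub>R e + 1 *\<^sub>R (f - of_int p *\<^sub>R e))"
    using min[OF unimodular_pair_shear(2)[OF ef', of "- (q - p)"]] by simp
qed (use c pqr in auto)

lemma three_unit_forms_unsorted:
  fixes c p q r :: int
  assumes "unimodular_pair e f" and "0 \<le> c"
    and W: "\<And>\<alpha> \<beta> :: real. wid us (\<alpha> *\<^sub>R e + \<beta> *\<^sub>R f)
              = c * \<bar>\<beta>\<bar> + \<bar>\<alpha> + \<beta> * p\<bar> + \<bar>\<alpha> + \<beta> * q\<bar> + \<bar>\<alpha> + \<beta> * r\<bar>"
    and "\<And>e f. unimodular_pair e f \<Longrightarrow> 3 \<le> wid us e"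
  shows "covering_pair us"
proof -
  consider "p \<le> q" "q \<le> r" | "p \<le> r" "r \<le> q" | "q \<le> p" "p \<le> r"
    | "q \<le> r" "r \<le> p" | "r \<le> p" "p \<le> q" | "r \<le> q" "q \<le> p" by linarith
  then show ?thesis
    by cases (rule three_unit_forms_sorted[OF assms(1,2) _ _ _ assms(4)], assumption, assumption,
        simp add: W, assumption)+
qed

text \<open>For even \<open>p\<close> the doubled form is a sum of two equal unit forms. For odd
  \<open>p\<close> a shear removes the offset of the unit form, and a reflection of \<open>f\<close>
  makes the other offset nonnegative.\<close>

lemma double_and_unit_form_dichotomy:
  fixes c p q :: int
  assumes ef: "unimodular_pair e f" and c: "0 \<le> c"
    and W: "\<And>\<alpha> \<beta> :: real. wid us (\<alpha> *\<^sub>R e + \<beta> *\<^sub>R f)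
              = c * \<bar>\<beta>\<bar> + \<bar>2 * \<alpha> + \<beta> * p\<bar> + \<bar>\<alpha> + \<beta> * q\<bar>"
    and min: "\<And>e f. unimodular_pair e f \<Longrightarrow> 3 \<le> wid us e"
  shows "covering_pair us \<or> P25_pair us"
proof (cases "even p")
  case True
  then obtain m where "p = 2 * m" by blast
  then have "\<bar>2 * \<alpha> + \<beta> * p\<bar> = \<bar>\<alpha> + \<beta> * m\<bar> + \<bar>\<alpha> + \<beta> * m\<bar>" for \<alpha> \<beta> :: real
    using abs_mult[of 2 "\<alpha> + \<beta> * m"] by (simp add: algebra_simps)
  then show ?thesis
    using three_unit_forms_unsorted[where p = m and q = m and r = q, OF ef c _ min] W by simp
next
  case False
  define P where "P = p - 2 * q"
  define \<sigma> :: int where "\<sigma> = (if 0 \<le> P then 1 else - 1)"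
  have \<sigma>: "\<bar>\<sigma>\<bar> = 1" "\<sigma> * P = \<bar>P\<bar>" "\<sigma> * \<sigma> = 1" by (auto simp: \<sigma>_def)
  let ?g = "of_int (- (\<sigma> * q)) *\<^sub>R e + of_int \<sigma> *\<^sub>R f"
  have eg: "unimodular_pair e ?g"
    using unimodular_pair_change[OF ef, of 1 \<sigma> 0 "- (\<sigma> * q)"] \<sigma> by simp
  show ?thesis
  proof (rule double_and_unit_form[OF eg c, where p = "\<bar>P\<bar>"])
    fix \<alpha> \<beta> :: real
    have *: "\<alpha> *\<^sub>R e + \<beta> *\<^sub>R ?g = (\<alpha> - \<beta> * \<sigma> * q) *\<^sub>R e + (\<beta> * \<sigma>) *\<^sub>R f"
      by (simp add: algebra_simps)
    have "\<beta> * real_of_int \<bar>P\<bar> = \<beta> * (\<sigma> * (p - 2 * q))"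
      using \<sigma>(2) by (metis P_def)
    moreover have "\<bar>\<beta> * \<sigma>\<bar> = \<bar>\<beta>\<bar>" using \<sigma>(1) by (auto simp: \<sigma>_def)
    ultimately show "wid us (\<alpha> *\<^sub>R e + \<beta> *\<^sub>R ?g) = c * \<bar>\<beta>\<bar> + \<bar>2 * \<alpha> + \<beta> * real_of_int \<bar>P\<bar>\<bar> + \<bar>\<alpha>\<bar>"
      unfolding * W by (simp add: algebra_simps del: of_int_abs)
  next
    show "3 \<le> wid us (of_int k *\<^sub>R e + 1 *\<^sub>R ?g)" for k
      using min[OF unimodular_pair_shear(2)[OF eg, of k]] by simp
  qed (use False in \<open>auto simp: P_def\<close>)
qed

lemma covering_or_P25_pair:
  assumes us: "set us \<subseteq> int_lattice" and min: "\<And>e f. unimodular_pair e f \<Longrightarrow> 3 \<le> wid us e"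
  shows "covering_pair us \<or> P25_pair us"
proof -
  obtain e f where ef: "unimodular_pair e f"
    and e: "\<And>e' f'. unimodular_pair e' f' \<Longrightarrow> wid us e \<le> wid us e'"
    using ex_minimal_pair[OF us] by blast
  have "wid us e \<in> \<int>" using us ef by (auto simp: unimodular_pair_def intro: wid_int)
  then obtain a where a: "wid us e = of_int a" by (auto elim: Ints_cases)
  show ?thesis
  proof (cases "4 \<le> wid us e")
    case True
    then show ?thesis using long_chords_minimal[OF ef] e ef unfolding covering_pair_def by blast
  next
    case False
    with a min[OF ef] have e3: "wid us e = 3" by simp
    obtain c :: int and vs :: "(int \<times> int) list" where c: "(0::int) \<le> c" and vs: "\<forall>v\<in>set vs. 0 < fst v"
      and "\<forall>\<alpha> \<beta> :: real. wid us (\<alpha> *\<^sub>R e + \<beta> *\<^sub>R f)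
        =
      c * \<bar>\<beta>\<bar> + (\<Sum>v\<leftarrow>vs. \<bar>\<alpha> * real_of_int (fst v) + \<beta> * real_of_int (snd v)\<bar>)"
      using wid_normal_form[OF us ef] by (elim exE conjE)
    note W = this(3)[rule_format]
    have "(\<Sum>v\<leftarrow>vs. \<bar>real_of_int (fst v)\<bar>) = real_of_int (\<Sum>v\<leftarrow>vs. fst v)"
      using vs by (induction vs) auto
    then have "(\<Sum>v\<leftarrow>vs. fst v) = 3" using W[of 1 0] e3 by simp
    from positive_sum_three_cases[OF vs this] show ?thesis
    proof (elim disjE exE)
      fix p assume "vs = [(3, p)]"
      then have "covering_pair us"
        using min[OF unimodular_pair_shear(2)[OF ef]] W
        by (intro triple_form[OF ef, where c = c and p = p]) (simp_all add: mult.commute)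
      then show ?thesis ..
    next
      fix p q assume "vs = [(2, p), (1, q)]"
      then show ?thesis
        by (intro double_and_unit_form_dichotomy[OF ef c _ min, where p = p and q = q])
           (simp_all add: W mult.commute)
    next
      fix p q assume "vs = [(1, q), (2, p)]"
      then show ?thesis
        by (intro double_and_unit_form_dichotomy[OF ef c _ min, where p = p and q = q])
           (simp_all add: W mult.commute)
    next
      fix p q r assume "vs = [(1, p), (1, q), (1, r)]"
      then have "covering_pair us"
        by (intro three_unit_forms_unsorted[OF ef c _ min, where p = p and q = q and r = r])
           (simp_all add: W)
      then show ?thesis ..
    qed
  qed
qed

section \<open>Equivalence with the exceptional parallelogram\<close>

text \<open>For an integer n the number |n| - n is 0 or -2 n, so every generator contributes an
  integer.\<close>

lemma half_wid_minus_inner_int: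
  assumes "set us \<subseteq> int_lattice" "z \<in> int_lattice"
  shows "(wid us z - z \<bullet> sum_list us) / 2 \<in> \<int>"
  using assms(1)
proof (induction us)
  case (Cons u us)
  have "z \<bullet> u \<in> \<int>" using Cons.prems assms(2) by (auto intro: inner_int_lattice)
  then have "(\<bar>z \<bullet> u\<bar> - z \<bullet> u) / 2 \<in> \<int>" by (auto simp: abs_if)
  moreover have "(wid us z - z \<bullet> sum_list us) / 2 \<in> \<int>" using Cons by simp
  ultimately have "(\<bar>z \<bullet> u\<bar> - z \<bullet> u) / 2 + (wid us z - z \<bullet> sum_list us) / 2 \<in> \<int>"
    by (rule Ints_add)
  then show ?case by (simp add: inner_add_right diff_divide_distrib add_divide_distrib algebra_simps)
qed simp

text \<open>The width function determines a zonotope up to translation; the translation is a lattice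
  vector because \<^term>\<open>wid us z\<close> and \<^term>\<open>z \<bullet> sum_list us\<close> have the same parity.\<close>
lemma zono_translate_if_wid_eq:
  assumes us: "set us \<subseteq> int_lattice" and ws: "set ws \<subseteq> int_lattice"
    and t: "t \<in> int_lattice" and eq: "\<And>z. wid us z = wid ws z"
  shows "\<exists>t'\<in>int_lattice. (+) t ` zono us = (+) t' ` zono ws"
proof -
  define t' where "t' = t + (1 / 2) *\<^sub>R (sum_list us - sum_list ws)"
  have "z \<bullet> (p - t) \<le> (z \<bullet> sum_list us + wid us z) / 2 \<longleftrightarrow>
        z \<bullet> (p - t') \<le> (z \<bullet> sum_list ws + wid ws z) / 2" for z p
  proof -
    have "z \<bullet> (p - t') = z \<bullet> (p - t) - (z \<bullet> sum_list us - z \<bullet> sum_list ws) / 2"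
      unfolding t'_def by (simp add: inner_diff_right inner_add_right)
    then show ?thesis unfolding eq by argo
  qed
  then have "(+) t ` zono us = (+) t' ` zono ws"
    by (auto simp: set_eq_iff mem_translate_iff mem_zono_iff)
  moreover have "t' $ i \<in> \<int>" for i
  proof -
    have z: "axis i 1 \<in> int_lattice" by (simp add: int_lattice_def axis_def)
    \<comment> \<open>The equal widths enter with opposite signs, so that each half difference is
      integral by parity.\<close>
    have "t' $ i = t $ i + ((wid ws (axis i 1) - axis i 1 \<bullet> sum_list ws) / 2
                         - (wid us (axis i 1) - axis i 1 \<bullet> sum_list us) / 2)"
      by (simp add: t'_def eq inner_axis' field_simps)
    also have "\<dots> \<in> \<int>"
      using t us ws z by (intro Ints_add Ints_diff half_wid_minus_inner_int) (auto simp: int_lattice_def)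
    finally show ?thesis .
  qed
  ultimately show ?thesis by (auto simp: int_lattice_def)
qed

text \<open>The basis \<open>p\<close>, \<open>q\<close> dual to \<open>e\<close>, \<open>f\<close>
  gives generators \<open>p\<close> and \<open>2 *\<^sub>R p + 5 *\<^sub>R q\<close> with the
  prescribed width function; the matrix with columns \<open>p\<close> and \<open>q\<close> maps
  \<open>P25\<close> to their zonotope.\<close>

lemma P25_pair_equivalent:
  assumes us: "set us \<subseteq> int_lattice" and t: "t \<in> int_lattice" and "P25_pair us"
  shows "unimodularly_equivalent ((+) t ` zono us) P25"
proof -
  obtain e f where ef: "unimodular_pair e f"
    and W: "\<And>\<alpha> \<beta> :: real. wid us (\<alpha> *\<^sub>R e + \<beta> *\<^sub>R f) = \<bar>\<alpha>\<bar> + \<bar>2 * \<alpha> + 5 * \<beta>\<bar>"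
    using assms(3) unfolding P25_pair_def by blast
  obtain p where p: "e \<bullet> p = 1" "f \<bullet> p = 0" "p \<in> int_lattice"
    using unimodular_pair_dual[OF ef, of 1 0] by auto
  obtain q where q: "e \<bullet> q = 0" "f \<bullet> q = 1" "q \<in> int_lattice"
    using unimodular_pair_dual[OF ef, of 0 1] by auto
  define ws where "ws = [p, 2 *\<^sub>R p + 5 *\<^sub>R q]"
  have ws: "set ws \<subseteq> int_lattice"
    using p q by (auto simp: ws_def int_lattice_2)
  have "wid us z = wid ws z" for z
  proof -
    obtain \<alpha> \<beta> where "z = \<alpha> *\<^sub>R e + \<beta> *\<^sub>R f" using unimodular_pair_span[OF ef] by blast
    then show ?thesis by (simp add: W ws_def inner_add_left inner_add_right p q algebra_simps)
  qed
  then obtain t' where t': "t' \<in> int_lattice" "(+) t ` zono us = (+) t' ` zono ws"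
    using zono_translate_if_wid_eq[OF us ws t] by blast
  define U :: "real ^ 2 ^ 2" where "U = vector [vector [p $ 1, q $ 1], vector [p $ 2, q $ 2]]"
  have U: "U *v x = x $ 1 *\<^sub>R p + x $ 2 *\<^sub>R q" for x
    by (simp add: U_def vec_eq_iff forall_2 matrix_vector_mult_def sum_2 algebra_simps)
  have "(e $ 1 * f $ 2 - e $ 2 * f $ 1) * (p $ 1 * q $ 2 - p $ 2 * q $ 1)
      = (e \<bullet> p) * (f \<bullet> q) - (e \<bullet> q) * (f \<bullet> p)"
    by (simp add: inner_2 algebra_simps)
  then have "\<bar>e $ 1 * f $ 2 - e $ 2 * f $ 1\<bar> * \<bar>p $ 1 * q $ 2 - p $ 2 * q $ 1\<bar> = 1"
    by (simp add: p q flip: abs_mult)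
  then have "\<bar>p $ 1 * q $ 2 - p $ 2 * q $ 1\<bar> = 1"
    using ef by (simp add: unimodular_pair_def)
  then have det: "\<bar>det U\<bar> = 1" by (simp add: U_def det_2 mult.commute)
  have int: "\<forall>i j. U $ i $ j \<in> \<int>"
    using p q by (simp add: U_def forall_2 int_lattice_2)
  have img: "((*v) U) ` (A + B) = ((*v) U) ` A + ((*v) U) ` B" for A B
    by (force simp: set_plus_def image_iff matrix_vector_right_distrib)
  have "((*v) U) ` P25 = zono ws"
    unfolding P25_def img
    by (simp add: closed_segment_linear_image[OF matrix_vector_mul_linear, symmetric] ws_def)
       (simp add: U)
  then have "(+) t ` zono us = (+) t' ` ((*v) U) ` P25" using t'(2) by argo
  then have "(+) t ` zono us = (\<lambda>x. U *v x + t') ` P25"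
    by (simp add: image_image add.commute)
  with det int t' show ?thesis unfolding unimodularly_equivalent_def by blast
qed

section \<open>Invariance of the covering radius under unimodular equivalence\<close>

definition covers :: "real \<Rightarrow> (real ^ 2) set \<Rightarrow> bool" where
  "covers \<rho> C \<longleftrightarrow> (\<lambda>x. \<rho> *\<^sub>R x) ` C + int_lattice = UNIV"

lemma covers_iff: "covers \<rho> C \<longleftrightarrow> (\<forall>x. \<exists>q\<in>C. \<exists>l\<in>int_lattice. x = \<rho> *\<^sub>R q + l)"
  unfolding covers_def set_eq_iff by (auto simp: set_plus_def)

lemma int_matrix_vector:
  fixes U :: "real ^ 2 ^ 2"
  assumes "\<forall>i j. U $ i $ j \<in> \<int>" "l \<in> int_lattice"
  shows "U *v l \<in> int_lattice"
  using assms by (auto simp: int_lattice_def matrix_vector_mult_def)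

lemma unimodular_inverse:
  fixes U :: "real ^ 2 ^ 2"
  assumes U: "\<forall>i j. U $ i $ j \<in> \<int>" and det: "\<bar>det U\<bar> = 1"
  obtains V :: "real ^ 2 ^ 2"
  where "\<forall>i j. V $ i $ j \<in> \<int>" "\<And>x. V *v (U *v x) = x" "\<And>x. U *v (V *v x) = x"
proof -
  define D where "D = det U"
  define V :: "real ^ 2 ^ 2" where
    "V = vector [vector [D * U $ 2 $ 2, - D * U $ 1 $ 2], vector [- D * U $ 2 $ 1, D * U $ 1 $ 1]]"
  have D: "D \<in> \<int>" "D * (U $ 1 $ 1 * U $ 2 $ 2 - U $ 1 $ 2 * U $ 2 $ 1) = 1"
    using det U abs_mult_self_eq[of D] by (auto simp: D_def det_2)
  have "V ** U = mat 1" "U ** V = mat 1"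
    using D(2)
    by (auto simp: V_def vec_eq_iff forall_2 matrix_matrix_mult_def sum_2 mat_def algebra_simps)
  then show thesis
    using D U by (intro that[of V]) (auto simp: V_def forall_2 matrix_vector_mul_assoc)
qed

text \<open>An integer matrix with integer inverse permutes the lattice, so both sets admit the same
  dilation factors.\<close>

lemma covering_radius_equivalent:
  fixes P Q :: "(real ^ 2) set"
  assumes "unimodularly_equivalent P Q"
  shows "covering_radius P = covering_radius Q"
proof -
  obtain U :: "real ^ 2 ^ 2" and t where U: "\<forall>i j. U $ i $ j \<in> \<int>" "\<bar>det U\<bar> = 1"
    and P: "P = (\<lambda>x. U *v x + t) ` Q"
    using assms unfolding unimodularly_equivalent_def by blast
  obtain V :: "real ^ 2 ^ 2" where V: "\<forall>i j. V $ i $ j \<in> \<int>" "\<And>x. V *v (U *v x) = x" "\<And>x. U *v (V *v x) = x"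
    using unimodular_inverse[OF U] by blast
  have "covers \<rho> P \<longleftrightarrow> covers \<rho> Q" for \<rho>
  proof
    assume P': "covers \<rho> P"
    show "covers \<rho> Q" unfolding covers_iff
    proof
      fix x
      \<comment> \<open>The shift by \<rho> t compensates for the dilated translation, which need
        not be a lattice vector.\<close>
      obtain q l where "q \<in> Q" "l \<in> int_lattice" and eq: "U *v x + \<rho> *\<^sub>R t = \<rho> *\<^sub>R (U *v q + t) + l"
        using P'[unfolded covers_iff P, rule_format, of "U *v x + \<rho> *\<^sub>R t"] by auto
      have "U *v x = U *v (\<rho> *\<^sub>R q) + l"
        using eq by (simp add: scaleR_right_distrib matrix_vector_mult_scaleR)
      then have "x = \<rho> *\<^sub>R q + V *v l"
        by (metis V(2) matrix_vector_right_distrib)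
      then show "\<exists>q\<in>Q. \<exists>l\<in>int_lattice. x = \<rho> *\<^sub>R q + l"
        using \<open>q \<in> Q\<close> int_matrix_vector[OF V(1) \<open>l \<in> int_lattice\<close>] by blast
    qed
  next
    assume Q': "covers \<rho> Q"
    show "covers \<rho> P" unfolding covers_iff
    proof
      fix x
      obtain q l where "q \<in> Q" "l \<in> int_lattice" and "V *v (x - \<rho> *\<^sub>R t) = \<rho> *\<^sub>R q + l"
        using Q'[unfolded covers_iff, rule_format, of "V *v (x - \<rho> *\<^sub>R t)"] by auto
      then have "x - \<rho> *\<^sub>R t = U *v (\<rho> *\<^sub>R q + l)" by (metis V(3))
      then have "x = \<rho> *\<^sub>R (U *v q + t) + U *v l"
        by (simp add: matrix_vector_right_distrib matrix_vector_mult_scaleR algebra_simps)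
      then show "\<exists>q\<in>P. \<exists>l\<in>int_lattice. x = \<rho> *\<^sub>R q + l"
        using \<open>q \<in> Q\<close> int_matrix_vector[OF U(1) \<open>l \<in> int_lattice\<close>] P by blast
    qed
  qed
  then show ?thesis by (simp add: covering_radius_def flip: covers_def)
qed

section \<open>Covering radius and area of \<open>P25\<close>\<close>

lemma mem_P25_iff:
  "x \<in> P25 \<longleftrightarrow> 0 \<le> x $ 2 \<and> x $ 2 \<le> 5 \<and> 0 \<le> 5 * x $ 1 - 2 * x $ 2 \<and> 5 * x $ 1 - 2 * x $ 2 \<le> 5"
proof
  assume "x \<in> P25"
  then obtain a b where "x = a + b" "a \<in> closed_segment 0 (vector [1, 0])"
    "b \<in> closed_segment 0 (vector [2, 5])"
    unfolding P25_def by (auto elim: set_plus_elim)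
  then obtain r s where "x = r *\<^sub>R vector [1, 0] + s *\<^sub>R vector [2, 5]"
    "0 \<le> r" "r \<le> 1" "0 \<le> s" "s \<le> 1"
    by (auto simp: in_segment)
  then show "0 \<le> x $ 2 \<and> x $ 2 \<le> 5 \<and> 0 \<le> 5 * x $ 1 - 2 * x $ 2 \<and> 5 * x $ 1 - 2 * x $ 2 \<le> 5"
    by simp
next
  assume x: "0 \<le> x $ 2 \<and> x $ 2 \<le> 5 \<and> 0 \<le> 5 * x $ 1 - 2 * x $ 2 \<and> 5 * x $ 1 - 2 * x $ 2 \<le> 5"
  define r s where "r = (5 * x $ 1 - 2 * x $ 2) / 5" and "s = x $ 2 / 5"
  have "x = r *\<^sub>R vector [1, 0] + s *\<^sub>R vector [2, 5]"
    by (simp add: vec_eq_iff forall_2 r_def s_def field_simps)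
  moreover have "r *\<^sub>R vector [1, 0] \<in> closed_segment 0 (vector [1, 0] :: real ^ 2)"
    using x unfolding in_segment by (intro exI[of _ r]) (auto simp: r_def)
  moreover have "s *\<^sub>R vector [2, 5] \<in> closed_segment 0 (vector [2, 5] :: real ^ 2)"
    using x unfolding in_segment by (intro exI[of _ s]) (auto simp: s_def)
  ultimately show "x \<in> P25" unfolding P25_def by (auto intro: set_plus_intro)
qed

lemma covers_P25_iff:
  assumes "0 < \<rho>"
  shows "covers \<rho> P25 \<longleftrightarrow> (\<forall>x y. \<exists>(k::int) (m::int). 0 \<le> y - m \<and> y - m \<le> 5 * \<rho> \<and>
     0 \<le> 5 * (x - k) - 2 * (y - m) \<and> 5 * (x - k) - 2 * (y - m) \<le> 5 * \<rho>)"
    (is "_ \<longleftrightarrow> (\<forall>x y. ?R x y)")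
proof -
  have "(\<exists>q\<in>P25. \<exists>l\<in>int_lattice. x = \<rho> *\<^sub>R q + l) \<longleftrightarrow> ?R (x $ 1) (x $ 2)" for x
  proof
    assume "\<exists>q\<in>P25. \<exists>l\<in>int_lattice. x = \<rho> *\<^sub>R q + l"
    then obtain q l where ql: "q \<in> P25" "l \<in> int_lattice" "x = \<rho> *\<^sub>R q + l" by blast
    then obtain k m where km: "l $ 1 = of_int k" "l $ 2 = of_int m"
      by (auto simp: int_lattice_2 elim!: Ints_cases)
    have "\<rho> * 0 \<le> \<rho> * q $ 2" "\<rho> * q $ 2 \<le> \<rho> * 5" "\<rho> * 0 \<le> \<rho> * (5 * q $ 1 - 2 * q $ 2)"
      "\<rho> * (5 * q $ 1 - 2 * q $ 2) \<le> \<rho> * 5"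
      using ql(1) assms unfolding mem_P25_iff by (auto intro: mult_left_mono)
    then show "?R (x $ 1) (x $ 2)"
      by - (rule exI[of _ k], rule exI[of _ m], simp add: ql(3) km algebra_simps)
  next
    assume "?R (x $ 1) (x $ 2)"
    then obtain k m :: int where km: "0 \<le> x $ 2 - m" "x $ 2 - m \<le> 5 * \<rho>"
      "0 \<le> 5 * (x $ 1 - k) - 2 * (x $ 2 - m)" "5 * (x $ 1 - k) - 2 * (x $ 2 - m) \<le> 5 * \<rho>" by blast
    define l :: "real ^ 2" where "l = vector [of_int k, of_int m]"
    define q where "q = (1 / \<rho>) *\<^sub>R (x - l)"
    have "q $ 2 = (x $ 2 - m) / \<rho>" "5 * q $ 1 - 2 * q $ 2 = (5 * (x $ 1 - k) - 2 * (x $ 2 - m)) / \<rho>"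
      by (simp_all add: q_def l_def diff_divide_distrib)
    then have "q \<in> P25"
      using km assms unfolding mem_P25_iff by (simp add: divide_le_eq mult.commute)
    moreover have "x = \<rho> *\<^sub>R q + l" using assms by (simp add: q_def)
    moreover have "l \<in> int_lattice" by (simp add: l_def int_lattice_2)
    ultimately show "\<exists>q\<in>P25. \<exists>l\<in>int_lattice. x = \<rho> *\<^sub>R q + l" by blast
  qed
  then have "covers \<rho> P25 \<longleftrightarrow> (\<forall>x :: real ^ 2. ?R (x $ 1) (x $ 2))"
    by (simp add: covers_iff)
  also have "\<dots> \<longleftrightarrow> (\<forall>x y. ?R x y)"
  proof (intro iffI allI)
    fix x y
    assume "\<forall>x :: real ^ 2. ?R (x $ 1) (x $ 2)"
    from this[rule_format, of "vector [x, y]"] show "?R x y" by simp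
  qed blast
  finally show ?thesis .
qed

text \<open>Horizontal slices of the dilated body have length 3/5, so one row of integer translates
  leaves gaps of length 2/5. The row below, whose slices at the same height start 2/5 further right,
  fills them.\<close>

lemma covers_P25: "covers (3 / 5) P25"
proof -
  have pos: "0 < (3 / 5 :: real)" by simp
  show ?thesis unfolding covers_P25_iff[OF pos]
  proof (intro allI)
    fix x y :: real
    define M where "M = \<lfloor>y\<rfloor>"
    have M: "0 \<le> y - M" "y - M < 1" unfolding M_def by linarith+
    \<comment> \<open>\<open>w\<close> is \<open>x\<close> measured from the left end of the slice
      in row \<open>M\<close>.\<close>
    define w where "w = x - (2 / 5) * (y - M)"
    define K where "K = \<lfloor>w\<rfloor>"
    have K: "0 \<le> w - K" "w - K < 1" unfolding K_def by linarith+
    show "\<exists>(k::int) (m::int). 0 \<le> y - m \<and> y - m \<le> 5 * (3 / 5) \<and>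
       0 \<le> 5 * (x - k) - 2 * (y - m) \<and> 5 * (x - k) - 2 * (y - m) \<le> 5 * (3 / 5)"
    proof (cases "w - K \<le> 3 / 5")
      case True
      with M K show ?thesis by - (rule exI[of _ K], rule exI[of _ M], auto simp: w_def field_simps)
    next
      case False
      with M K show ?thesis by - (rule exI[of _ K], rule exI[of _ "M - 1"], auto simp: w_def field_simps)
    qed
  qed
qed

lemma not_covers_P25:
  assumes "0 < \<rho>" "\<rho> < 3 / 5"
  shows "\<not> covers \<rho> P25"
proof
  assume "covers \<rho> P25"
  note C = this[unfolded covers_P25_iff[OF assms(1)], rule_format]
  \<comment> \<open>Half the deficit of 5 \<rho> against 3.\<close>
  define \<delta> where "\<delta> = (3 - 5 * \<rho>) / 2"
  have \<delta>: "0 < \<delta>" "5 * \<rho> = 3 - 2 * \<delta>" "\<delta> < 3 / 2" using assms by (auto simp: \<delta>_def field_simps)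
  obtain k m :: int where km: "0 \<le> 3 - \<delta> - m" "3 - \<delta> - m \<le> 5 * \<rho>"
    "0 \<le> 5 * ((7 - 3 * \<delta>) / 5 - k) - 2 * (3 - \<delta> - m)"
    "5 * ((7 - 3 * \<delta>) / 5 - k) - 2 * (3 - \<delta> - m) \<le> 5 * \<rho>"
    \<comment> \<open>At height 3 - \<delta> only the rows m = 1 and m = 2 are available. The point
      lies just right of the translate k = 0 in the first and just left of k = 1 in the second, each
      time by \<delta> in terms of 5 x - 2 y.\<close>
    using C[of "3 - \<delta>" "(7 - 3 * \<delta>) / 5"] by blast
  have "real_of_int 0 < m" "real_of_int m < real_of_int 3" using km \<delta> by simp_all
  then have "m = 1 \<or> m = 2" by linarith
  moreover have "0 \<le> 1 - \<delta> + 2 * real_of_int m - 5 * real_of_int k" "1 - \<delta> + 2 * real_of_int m - 5 * real_of_int k \<le> 3 - 2 * \<delta>"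
    using km(3,4) \<delta> by argo+
  moreover have "real_of_int k \<le> 0 \<or> 1 \<le> real_of_int k" by (cases "k \<le> 0") auto
  ultimately show False using \<delta> by auto
qed

lemma covering_radius_P25: "covering_radius P25 = 3 / 5"
  unfolding covering_radius_def
proof (rule cInf_eq_minimum)
  show "3 / 5 \<in> {\<rho>. 0 < \<rho> \<and> (\<lambda>x. \<rho> *\<^sub>R x) ` P25 + int_lattice = UNIV}"
    using covers_P25 by (simp add: covers_def)
next
  fix \<rho> assume "\<rho> \<in> {\<rho>. 0 < \<rho> \<and> (\<lambda>x. \<rho> *\<^sub>R x) ` P25 + int_lattice = UNIV}"
  then show "3 / 5 \<le> \<rho>" using not_covers_P25[of \<rho>] by (force simp: covers_def)
qed

text \<open>\<open>P25\<close> is the image of the unit square under a matrix of determinant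
  5.\<close>

lemma measure_P25: "measure lborel P25 = 5"
proof -
  define U :: "real ^ 2 ^ 2" where "U = vector [vector [1, 2], vector [0, 5]]"
  have U: "U *v x = vector [x $ 1 + 2 * x $ 2, 5 * x $ 2]" for x
    by (simp add: U_def vec_eq_iff forall_2 matrix_vector_mult_def sum_2)
  have P: "P25 = (*v) U ` cbox 0 1"
  proof (intro equalityI subsetI)
    fix x assume "x \<in> P25"
    then show "x \<in> (*v) U ` cbox 0 1"
      unfolding mem_P25_iff
      by (intro image_eqI[of _ _ "vector [x $ 1 - 2 / 5 * x $ 2, x $ 2 / 5]"])
         (auto simp: U vec_eq_iff forall_2 mem_box_cart)
  next
    fix x assume "x \<in> (*v) U ` cbox 0 1"
    then show "x \<in> P25" by (auto simp: U mem_P25_iff mem_box_cart forall_2)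
  qed
  have "compact P25"
    unfolding P by (intro compact_continuous_image matrix_vector_mult_linear_continuous_on compact_cbox)
  then have "measure lborel P25 = measure lebesgue P25"
    by (simp add: borel_compact)
  also have "\<dots> = \<bar>det U\<bar> * measure lebesgue (cbox 0 1 :: (real ^ 2) set)"
    unfolding P by (subst measure_linear_image) (auto simp: matrix_vector_mul_linear matrix_of_matrix_vector_mul)
  also have "\<dots> = 5"
    by (simp add: U_def det_2 content_cbox_if_cart interval_eq_empty_cart)
  finally show ?thesis .
qed

theorem theorem4:
  shows "(\<forall>Z. lattice_2_zonotope Z \<and> lattice_width Z \<ge> 3 \<longrightarrow>
            (covering_radius Z \<le> 1 / 2 \<longleftrightarrow> \<not> unimodularly_equivalent Z P25)) \<and>
         measure lborel P25 = 5 \<and>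
         covering_radius P25 = 3 / 5"
proof (intro conjI allI impI)
  fix Z :: "(real ^ 2) set"
  assume "lattice_2_zonotope Z \<and> lattice_width Z \<ge> 3"
  then obtain us t where us: "set us \<subseteq> int_lattice" and t: "t \<in> int_lattice"
    and Z: "Z = (+) t ` zono us" and width: "lattice_width Z \<ge> 3"
    unfolding lattice_2_zonotope_def by blast
  have "3 \<le> wid us e" if "unimodular_pair e f" for e f
  proof -
    have "e \<in> int_lattice" "e \<noteq> 0" using that by (auto simp: unimodular_pair_def)
    then show ?thesis using lattice_width_le_wid[of e t us] width by (simp add: Z)
  qed
  then consider "covering_pair us" | "P25_pair us"
    using covering_or_P25_pair[OF us] by blast
  then show "covering_radius Z \<le> 1 / 2 \<longleftrightarrow> \<not> unimodularly_equivalent Z P25"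
  proof cases
    case 1
    then have "(\<lambda>x. (1 / 2) *\<^sub>R x) ` Z + int_lattice = UNIV"
      unfolding covering_pair_def Z by (auto simp: long_chords_covers)
    then have "covering_radius Z \<le> 1 / 2"
      unfolding covering_radius_def by (intro cInf_lower bdd_belowI[of _ 0]) auto
    \<comment> \<open>The two cases exclude each other because 3/5 exceeds 1/2, which gives the
      equivalence and not just one implication.\<close>
    moreover have "\<not> unimodularly_equivalent Z P25"
    proof
      assume "unimodularly_equivalent Z P25"
      then have "covering_radius Z = 3 / 5"
        by (simp add: covering_radius_equivalent covering_radius_P25)
      with \<open>covering_radius Z \<le> 1 / 2\<close> show False by simp
    qed
    ultimately show ?thesis by simp
  next
    case 2
    then have "unimodularly_equivalent Z P25"
      unfolding Z by (rule P25_pair_equivalent[OF us t])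
    then show ?thesis by (simp add: covering_radius_equivalent covering_radius_P25)
  qed
qed (rule measure_P25 covering_radius_P25)+

end
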